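(* If a ($T_0$) topological space $X$ is a $P$-space, then the groups $FP(X)$ and $AP(X)$ have the direct limit property; that is, for $PG(X)$ equal to either $FP(X)$ or $AP(X)$, a set $F\subset PG(X)$ is closed in $PG(X)$ if and only if $F\cap B_n(X)$ is closed in $B_n(X)$ for each $n\in\mathbb{N}$.
   Context: All spaces are assumed to be $T_0$. A paratopological group is a group with a topology such that the multiplication $G\times G\to G$ is jointly continuous. The Markov free paratopological group $FP(X)$ on $X$ is a paratopological group $G$ containing $X$ as a topological subspace such that (1) $X$ generates $G$ algebraically, and (2) each continuous mapping $f:X\to H$ to a paratopological group $H$ extends to a continuous homomorphism $\hat f:G\to H$. The Markov free Abelian paratopological group $AP(X)$ is defined in the same way with all groups Abelian. As abstract groups, $FP(X)$ is the free group and $AP(X)$ is the free Abelian group on the set $X$. For a non-negative integer $n$, $B_n(X)$ denotes the subspace of $FP(X)$ (respectively $AP(X)$) consisting of all words of reduced length $\le n$ with respect to the free basis $X$. A space is called a $P$-space if each of its $G_\delta$-subsets is open. *)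

theory Defs
  imports "HOL-Analysis.Analysis" "HOL-Algebra.Generated_Groups"
begin

definition P_space :: "'a topology \<Rightarrow> bool" where
  "P_space X \<longleftrightarrow> (\<forall>S. gdelta_in X S \<longrightarrow> openin X S)"

text \<open>Every space is understood to be \<open>T\<^sub>0\<close>, so this is part of the definition of a
  paratopological group.\<close>

definition paratopological_group :: "('g, 'm) monoid_scheme \<Rightarrow> 'g topology \<Rightarrow> bool" where
  "paratopological_group G T \<longleftrightarrow>
     group G \<and> topspace T = carrier G \<and> t0_space T \<and>
     continuous_map (prod_topology T T) T (\<lambda>(x, y). x \<otimes>\<^bsub>G\<^esub> y)"

text \<open>Group words over an alphabet: \<open>(x, True)\<close> is the letter \<open>x\<close>, and
  \<open>(x, False)\<close> is its formal inverse.\<close>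

type_synonym 'a group_word = "('a \<times> bool) list"

definition extends_continuously ::
  "'a topology \<Rightarrow> ('a \<Rightarrow> 'g) \<Rightarrow> ('g, 'm) monoid_scheme \<Rightarrow> 'g topology \<Rightarrow>
   ('h, 'n) monoid_scheme \<Rightarrow> 'h topology \<Rightarrow> bool" where
  "extends_continuously X i G T H S \<longleftrightarrow>
     (\<forall>f. continuous_map X S f \<longrightarrow>
        (\<exists>h \<in> hom G H. continuous_map T S h \<and> (\<forall>x \<in> topspace X. h (i x) = f x)))"

text \<open>\<open>(G, T)\<close> is the Markov free (Abelian) paratopological group on \<open>X\<close>; the embedding \<open>i\<close>
  takes the place of the inclusion of \<open>X\<close> in \<open>G\<close>.

  HOL cannot quantify over the type that carries the test group \<open>H\<close>. Letting \<open>H\<close> range over the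
  group structures with carrier in the fixed type of group words over \<open>'a\<close> loses nothing. Given a
  continuous \<open>f\<close> from \<open>X\<close> to a paratopological group on any type, replace the target by the
  subgroup generated by the image of \<open>f\<close>, with the subspace topology. It is again a
  \<open>T\<^sub>0\<close> paratopological group (Abelian if the target is), and each of its elements is the value of
  a group word over \<open>X\<close>, so it is isomorphic to a group carried by a set of group words. The type
  \<open>'g\<close> would not do here: it may be finite, and then it could not test freeness.\<close>

definition free_paratopological_group ::
  "'a topology \<Rightarrow> ('g, 'm) monoid_scheme \<Rightarrow> 'g topology \<Rightarrow> ('a \<Rightarrow> 'g) \<Rightarrow> bool" where
  "free_paratopological_group X G T i \<longleftrightarrow>
     paratopological_group G T \<and>
     embedding_map X T i \<and>
     generate G (i ` topspace X) = carrier G \<and>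
     (\<forall>(H :: 'a group_word monoid) S.
        paratopological_group H S \<longrightarrow> extends_continuously X i G T H S)"

definition free_abelian_paratopological_group ::
  "'a topology \<Rightarrow> ('g, 'm) monoid_scheme \<Rightarrow> 'g topology \<Rightarrow> ('a \<Rightarrow> 'g) \<Rightarrow> bool" where
  "free_abelian_paratopological_group X G T i \<longleftrightarrow>
     comm_group G \<and> paratopological_group G T \<and>
     embedding_map X T i \<and>
     generate G (i ` topspace X) = carrier G \<and>
     (\<forall>(H :: 'a group_word monoid) S.
        comm_group H \<and> paratopological_group H S \<longrightarrow> extends_continuously X i G T H S)"

definition word_value :: "('g, 'm) monoid_scheme \<Rightarrow> ('a \<Rightarrow> 'g) \<Rightarrow> 'a group_word \<Rightarrow> 'g" where
  "word_value G i w =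
     foldr (\<lambda>(x, b) g. (if b then i x else inv\<^bsub>G\<^esub> (i x)) \<otimes>\<^bsub>G\<^esub> g) w \<one>\<^bsub>G\<^esub>"

definition reduced_word :: "'a group_word \<Rightarrow> bool" where
  "reduced_word w \<longleftrightarrow> successively (\<lambda>(x, b) (y, c). \<not> (x = y \<and> b \<noteq> c)) w"

text \<open>In an Abelian group a letter cancels against its inverse wherever the two occur.\<close>

definition abelian_reduced_word :: "'a group_word \<Rightarrow> bool" where
  "abelian_reduced_word w \<longleftrightarrow> \<not> (\<exists>x. (x, True) \<in> set w \<and> (x, False) \<in> set w)"

text \<open>The sets \<open>B\<^sub>n(X)\<close> for \<open>FP(X)\<close> and for \<open>AP(X)\<close>.\<close>

definition free_ball ::
  "'a topology \<Rightarrow> ('g, 'm) monoid_scheme \<Rightarrow> ('a \<Rightarrow> 'g) \<Rightarrow> nat \<Rightarrow> 'g set" where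
  "free_ball X G i n =
     {word_value G i w | w. fst ` set w \<subseteq> topspace X \<and> reduced_word w \<and> length w \<le> n}"

definition free_abelian_ball ::
  "'a topology \<Rightarrow> ('g, 'm) monoid_scheme \<Rightarrow> ('a \<Rightarrow> 'g) \<Rightarrow> nat \<Rightarrow> 'g set" where
  "free_abelian_ball X G i n =
     {word_value G i w | w. fst ` set w \<subseteq> topspace X \<and> abelian_reduced_word w \<and> length w \<le> n}"

definition direct_limit_property :: "'g topology \<Rightarrow> (nat \<Rightarrow> 'g set) \<Rightarrow> bool" where
  "direct_limit_property T B \<longleftrightarrow>
     (\<forall>F \<subseteq> topspace T.
        closedin T F \<longleftrightarrow> (\<forall>n. closedin (subtopology T (B n)) (F \<inter> B n)))"

end

theory Submission
  imports Defs
begin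

text \<open>The topology of the free group on a \<open>P\<close>-space \<open>X\<close> makes it a \<open>P\<close>-space: refining it by
  its \<open>G\<^sub>\<delta>\<close>-sets keeps the multiplication and the embedding of \<open>X\<close> continuous, so by the universal
  property the identity is continuous into the refinement. Now let \<open>F \<inter> B\<^sub>n\<close> be closed in \<open>B\<^sub>n\<close>
  for all \<open>n\<close>, and let \<open>g \<in> B\<^sub>n - F\<close>. For \<open>m \<ge> n\<close> the point \<open>g\<close> lies in \<open>B\<^sub>m\<close>, hence outside the
  closure of \<open>F \<inter> B\<^sub>m\<close> in the whole group, and the complements of these closures intersect in an
  open neighbourhood of \<open>g\<close> that misses \<open>F\<close>. The balls themselves need not be closed.\<close>

section \<open>Direct limits over increasing balls in a P-space\<close>

lemma P_space_INT:
  assumes "P_space X" "\<And>n::nat. openin X (U n)"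
  shows "openin X (\<Inter>n. U n)"
proof -
  have "gdelta_in X (\<Inter>(range U))"
    by (rule gdelta_in_Inter) (auto simp: assms open_imp_gdelta_in)
  then show ?thesis
    using assms(1) by (auto simp: P_space_def)
qed

lemma direct_limit_property_P_space:
  assumes P: "P_space T" and "incseq B" and un: "(\<Union>n. B n) = topspace T"
  shows "direct_limit_property T B"
  unfolding direct_limit_property_def
proof (intro allI impI iffI)
  fix F n
  assume "closedin T F"
  then show "closedin (subtopology T (B n)) (F \<inter> B n)"
    by (auto simp: closedin_subtopology)
next
  fix F
  assume F: "F \<subseteq> topspace T" "\<forall>n. closedin (subtopology T (B n)) (F \<inter> B n)"
  then obtain C where C: "\<And>n. closedin T (C n)" "\<And>n. F \<inter> B n = C n \<inter> B n"
    by (auto simp: closedin_subtopology) metis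
  have "\<exists>U. openin T U \<and> g \<in> U \<and> U \<subseteq> topspace T - F" if g: "g \<in> topspace T - F" for g
  proof -
    obtain n where n: "g \<in> B n"
      using un g by auto
    \<comment> \<open>The closed set \<open>C m\<close> agrees with \<open>F\<close> only inside
      \<open>B m\<close>; outside it, \<open>C m\<close> may well contain \<open>g\<close>. So the
      intersection starts at \<open>n\<close>, from where on \<open>g\<close> lies in every
      ball.\<close>
    define U where "U = (\<Inter>k. topspace T - C (n + k))"
    have "openin T U"
      unfolding U_def using C(1) by (intro P_space_INT[OF P]) auto
    moreover have "g \<in> U"
    proof -
      have "g \<in> B (n + k)" for k
        using n incseqD[OF \<open>incseq B\<close>, of n "n + k"] by auto
      then show ?thesis
        using g C(2) by (auto simp: U_def)
    qed
    moreover have "x \<notin> F" if "x \<in> U" for x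
    proof
      assume "x \<in> F"
      then obtain m where "x \<in> B m"
        using F(1) un by auto
      \<comment> \<open>The index \<open>m\<close> may be below \<open>n\<close>; enlarging it to
        \<open>n + m\<close> reaches a ball whose \<open>C\<close> was removed in forming
        \<open>U\<close>.\<close>
      then have "x \<in> B (n + m)"
        using incseqD[OF \<open>incseq B\<close>, of m "n + m"] by auto
      then show False
        using C(2)[of "n + m"] \<open>x \<in> F\<close> that by (auto simp: U_def)
    qed
    ultimately show ?thesis
      by (meson DiffI openin_subset subset_eq)
  qed
  then have "openin T (topspace T - F)"
    by (subst openin_subopen) blast
  then show "closedin T F"
    using F(1) by (simp add: closedin_def)
qed

section \<open>The refinement of a topology by its G-delta sets\<close>

text \<open>This is the topology with the G-delta sets as a base. The pointwise form makes closure
  under unions immediate, and closure under finite intersections comes from that of G-delta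
  sets.\<close>

definition P_modification :: "'a topology \<Rightarrow> 'a topology" where
  "P_modification T = topology (\<lambda>U. \<forall>x\<in>U. \<exists>W. gdelta_in T W \<and> x \<in> W \<and> W \<subseteq> U)"

lemma openin_P_modification:
  "openin (P_modification T) U \<longleftrightarrow> (\<forall>x\<in>U. \<exists>W. gdelta_in T W \<and> x \<in> W \<and> W \<subseteq> U)"
proof -
  have "istopology (\<lambda>U. \<forall>x\<in>U. \<exists>W. gdelta_in T W \<and> x \<in> W \<and> W \<subseteq> U)"
    unfolding istopology_def
  proof (intro conjI allI impI ballI)
    fix U V x
    assume "\<forall>x\<in>U. \<exists>W. gdelta_in T W \<and> x \<in> W \<and> W \<subseteq> U"
      "\<forall>x\<in>V. \<exists>W. gdelta_in T W \<and> x \<in> W \<and> W \<subseteq> V" "x \<in> U \<inter> V"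
    then obtain W W' where "gdelta_in T W" "x \<in> W" "W \<subseteq> U" "gdelta_in T W'" "x \<in> W'" "W' \<subseteq> V"
      by (meson IntD1 IntD2)
    then show "\<exists>W. gdelta_in T W \<and> x \<in> W \<and> W \<subseteq> U \<inter> V"
      by (intro exI[of _ "W \<inter> W'"]) (auto simp: gdelta_in_Int)
  next
    fix \<K> x
    assume "\<forall>K\<in>\<K>. \<forall>x\<in>K. \<exists>W. gdelta_in T W \<and> x \<in> W \<and> W \<subseteq> K" "x \<in> \<Union>\<K>"
    then show "\<exists>W. gdelta_in T W \<and> x \<in> W \<and> W \<subseteq> \<Union>\<K>"
      by (meson Union_iff Sup_upper subset_trans)
  qed
  then show ?thesis
    by (simp add: P_modification_def)
qed

lemma gdelta_in_imp_openin_P_modification: "gdelta_in T W \<Longrightarrow> openin (P_modification T) W"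
  by (auto simp: openin_P_modification)

lemma openin_imp_openin_P_modification: "openin T U \<Longrightarrow> openin (P_modification T) U"
  by (simp add: gdelta_in_imp_openin_P_modification open_imp_gdelta_in)

lemma topspace_P_modification [simp]: "topspace (P_modification T) = topspace T"
proof
  show "topspace (P_modification T) \<subseteq> topspace T"
    using openin_topspace[of "P_modification T"] unfolding openin_P_modification
    by (meson gdelta_in_subset subset_iff)
  show "topspace T \<subseteq> topspace (P_modification T)"
    by (simp add: openin_imp_openin_P_modification openin_subset)
qed

text \<open>The preimage of a G-delta set is a countable intersection of open sets, hence open in a
  P-space. Applied to the embedding of \<open>X\<close>, this keeps it continuous after the
  refinement.\<close>

lemma continuous_map_P_modification:
  assumes "P_space X" and f: "continuous_map X T f"
  shows "continuous_map X (P_modification T) f"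
  unfolding continuous_map_alt
proof (intro conjI allI impI)
  fix U
  assume U: "openin (P_modification T) U"
  have "\<exists>V. openin X V \<and> x \<in> V \<and> V \<subseteq> f -` U \<inter> topspace X" if x: "x \<in> f -` U \<inter> topspace X" for x
  proof -
    obtain W where W: "gdelta_in T W" "f x \<in> W" "W \<subseteq> U"
      using U x by (auto simp: openin_P_modification)
    then obtain C where C: "\<And>n::nat. openin T (C n)" "\<Inter>(range C) = W"
      by (auto simp: gdelta_in_descending)
    have "openin X (\<Inter>n. f -` C n \<inter> topspace X)"
      using f C(1) by (intro P_space_INT[OF assms(1)]) (auto simp: continuous_map_alt)
    then show ?thesis
      using W C(2) x by (intro exI[of _ "\<Inter>n. f -` C n \<inter> topspace X"]) auto
  qed
  then show "openin X (f -` U \<inter> topspace X)"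
    by (subst openin_subopen) blast
next
  show "f \<in> topspace X \<rightarrow> topspace (P_modification T)"
    using f by (simp add: continuous_map_def)
qed

text \<open>An intersection of boxes is the box of the intersections. Choosing an open box around
  the point for each of the countably many open sets that cut out \<open>W\<close> thus gives a box
  of two G-delta sets, so both factors can be refined separately.\<close>

lemma continuous_map_prod_P_modification:
  assumes f: "continuous_map (prod_topology T T') S f"
  shows "continuous_map (prod_topology (P_modification T) (P_modification T')) (P_modification S) f"
  unfolding continuous_map_alt
proof (intro conjI allI impI)
  fix U
  assume U: "openin (P_modification S) U"
  let ?D = "topspace T \<times> topspace T'"
  have "\<exists>A B. openin (P_modification T) A \<and> openin (P_modification T') B \<and> x \<in> A \<and> y \<in> B \<and>
      A \<times> B \<subseteq> f -` U \<inter> ?D" if xy: "(x, y) \<in> f -` U \<inter> ?D" for x y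
  proof -
    obtain W where W: "gdelta_in S W" "f (x, y) \<in> W" "W \<subseteq> U"
      using U xy by (auto simp: openin_P_modification)
    then obtain C where C: "\<And>n::nat. openin S (C n)" "\<Inter>(range C) = W"
      by (auto simp: gdelta_in_descending)
    have "\<exists>A B. openin T A \<and> openin T' B \<and> x \<in> A \<and> y \<in> B \<and> A \<times> B \<subseteq> f -` C n \<inter> ?D" for n
    proof -
      have "openin (prod_topology T T') (f -` C n \<inter> ?D)"
        using f C(1) by (auto simp: continuous_map_alt)
      moreover have "(x, y) \<in> f -` C n \<inter> ?D"
        using C(2) W(2) xy by auto
      ultimately show ?thesis
        unfolding openin_prod_topology_alt by blast
    qed
    then obtain A B where AB: "\<And>n. openin T (A n)" "\<And>n. openin T' (B n)" "\<And>n. x \<in> A n"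
      "\<And>n. y \<in> B n" "\<And>n. A n \<times> B n \<subseteq> f -` C n \<inter> ?D"
      by metis
    have "gdelta_in T (\<Inter>(range A))" "gdelta_in T' (\<Inter>(range B))"
      by (rule gdelta_in_Inter; auto simp: AB open_imp_gdelta_in)+
    moreover have "\<Inter>(range A) \<times> \<Inter>(range B) \<subseteq> f -` U \<inter> ?D"
    proof
      fix p
      assume "p \<in> \<Inter>(range A) \<times> \<Inter>(range B)"
      then have "p \<in> f -` C n \<inter> ?D" for n
        using AB(5)[of n] by blast
      then show "p \<in> f -` U \<inter> ?D"
        using C(2) W(3) by auto
    qed
    ultimately show ?thesis
      using AB(3,4)
      by (intro exI[of _ "\<Inter>(range A)"] exI[of _ "\<Inter>(range B)"])
        (auto simp: gdelta_in_imp_openin_P_modification)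
  qed
  then show "openin (prod_topology (P_modification T) (P_modification T'))
      (f -` U \<inter> topspace (prod_topology (P_modification T) (P_modification T')))"
    unfolding openin_prod_topology_alt by simp
next
  show "f \<in> topspace (prod_topology (P_modification T) (P_modification T'))
      \<rightarrow> topspace (P_modification S)"
    using f by (simp add: continuous_map_def)
qed

lemma paratopological_group_P_modification:
  assumes "paratopological_group G T"
  shows "paratopological_group G (P_modification T)"
proof -
  have "t0_space (P_modification T)" if "t0_space T"
    unfolding t0_space_def topspace_P_modification
  proof (intro ballI impI)
    fix x y
    assume "x \<in> topspace T" "y \<in> topspace T" "x \<noteq> y"
    then obtain U where "openin T U" "x \<notin> U \<longleftrightarrow> y \<in> U"
      using \<open>t0_space T\<close> unfolding t0_space_def by metis
    then show "\<exists>U. openin (P_modification T) U \<and> (x \<notin> U) = (y \<in> U)"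
      using openin_imp_openin_P_modification by blast
  qed
  then show ?thesis
    using assms by (simp add: paratopological_group_def continuous_map_prod_P_modification)
qed

section \<open>Transport along isomorphisms and uniqueness of extensions\<close>

text \<open>The universal property only tests groups carried by words, so the refined group must be
  copied to that type. Injectivity of \<open>\<psi>\<close> preserves the separation axiom;
  multiplication in \<open>H\<close> followed by \<open>\<psi>\<close> equals \<open>\<psi>\<close>
  on both factors followed by multiplication in \<open>G\<close>, which is continuous.\<close>

lemma paratopological_group_pullback:
  assumes pG: "paratopological_group G T" and "group H" and \<psi>: "\<psi> \<in> iso H G"
  shows "paratopological_group H (pullback_topology (carrier H) \<psi> T)"
proof -
  let ?S = "pullback_topology (carrier H) \<psi> T"
  have T: "topspace T = carrier G" "t0_space T"
    and mult: "continuous_map (prod_topology T T) T (\<lambda>(x, y). x \<otimes>\<^bsub>G\<^esub> y)"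
    using pG by (auto simp: paratopological_group_def)
  have \<psi>': "\<psi> \<in> hom H G" "inj_on \<psi> (carrier H)" "\<psi> \<in> carrier H \<rightarrow> carrier G"
    using \<psi> by (auto simp: iso_def bij_betw_def)
  have S: "topspace ?S = carrier H"
    using \<psi>' T by (auto simp: topspace_pullback_topology)
  have \<psi>_cont: "continuous_map ?S T \<psi>"
    using continuous_map_pullback[OF continuous_map_id, of "carrier H" \<psi> T] by (simp add: comp_def)
  have "t0_space ?S"
    unfolding t0_space_def S
  proof (intro ballI impI)
    fix x y
    assume xy: "x \<in> carrier H" "y \<in> carrier H" "x \<noteq> y"
    then have "\<psi> x \<noteq> \<psi> y" "\<psi> x \<in> carrier G" "\<psi> y \<in> carrier G"
      using \<psi>' by (auto dest: inj_onD)
    then obtain U where "openin T U" "\<psi> x \<notin> U \<longleftrightarrow> \<psi> y \<in> U"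
      using T unfolding t0_space_def by metis
    with xy show "\<exists>U. openin ?S U \<and> (x \<notin> U) = (y \<in> U)"
      by (intro exI[of _ "\<psi> -` U \<inter> carrier H"]) (auto simp: openin_pullback_topology)
  qed
  moreover have "continuous_map (prod_topology ?S ?S) ?S (\<lambda>(x, y). x \<otimes>\<^bsub>H\<^esub> y)"
  proof (rule continuous_map_pullback')
    have "continuous_map (prod_topology ?S ?S) (prod_topology T T) (\<lambda>(x, y). (\<psi> x, \<psi> y))"
      using \<psi>_cont by (simp add: continuous_map_prod_top)
    then have "continuous_map (prod_topology ?S ?S) T
        ((\<lambda>(x, y). x \<otimes>\<^bsub>G\<^esub> y) \<circ> (\<lambda>(x, y). (\<psi> x, \<psi> y)))"
      using mult by (rule continuous_map_compose)
    then show "continuous_map (prod_topology ?S ?S) T (\<psi> \<circ> (\<lambda>(x, y). x \<otimes>\<^bsub>H\<^esub> y))"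
      by (rule continuous_map_eq) (use \<psi>'(1) S in \<open>auto simp: hom_mult\<close>)
    show "topspace (prod_topology ?S ?S) \<subseteq> (\<lambda>(x, y). x \<otimes>\<^bsub>H\<^esub> y) -` carrier H"
      using S \<open>group H\<close> by (auto simp: group.is_monoid monoid.m_closed)
  qed
  ultimately show ?thesis
    using \<open>group H\<close> S by (simp add: paratopological_group_def)
qed

text \<open>The universal property asserts only that an extension exists; this supplies its
  uniqueness, by induction on the generation of \<open>g\<close>.\<close>

lemma hom_eq_on_generate:
  assumes "group G" "group H" "h \<in> hom G H" "k \<in> hom G H" "A \<subseteq> carrier G"
    and eq: "\<And>a. a \<in> A \<Longrightarrow> h a = k a" and "g \<in> generate G A"
  shows "h g = k g"
  using assms(7)
proof (induction rule: generate.induct)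
  case one
  show ?case
    using assms by (metis hom_one)
next
  case (incl a)
  then show ?case by (rule eq)
next
  case (inv a)
  then have "a \<in> carrier G"
    using assms by blast
  then show ?case
    using assms eq[OF inv] group_hom.hom_inv[of G H] by (metis group_hom.intro group_hom_axioms.intro)
next
  case (eng a b)
  then show ?case
    using assms group.generate_in_carrier[OF \<open>group G\<close> \<open>A \<subseteq> carrier G\<close>] by (simp add: hom_mult)
qed

section \<open>Word values, cancellation and exhaustion by balls\<close>

lemma word_value_Nil [simp]: "word_value G i [] = \<one>\<^bsub>G\<^esub>"
  by (simp add: word_value_def)

lemma word_value_Cons [simp]:
  "word_value G i ((x, b) # w) =
     (if b then i x else inv\<^bsub>G\<^esub> (i x)) \<otimes>\<^bsub>G\<^esub> word_value G i w"
  by (simp add: word_value_def)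

context group
begin

lemma word_value_closed [simp]:
  "i ` fst ` set w \<subseteq> carrier G \<Longrightarrow> word_value G i w \<in> carrier G"
  by (induction w) auto

lemma word_value_append:
  assumes "i ` fst ` set u \<subseteq> carrier G" "i ` fst ` set v \<subseteq> carrier G"
  shows "word_value G i (u @ v) = word_value G i u \<otimes> word_value G i v"
  using assms by (induction u) (auto simp: m_assoc)

text \<open>Serves twice: to name group elements by words when a test group is built, and to start
  the reduction showing that the balls exhaust the group. The word found need not be
  reduced.\<close>

lemma generate_word_value:
  assumes "i ` A \<subseteq> carrier G" "g \<in> generate G (i ` A)"
  shows "\<exists>w. fst ` set w \<subseteq> A \<and> word_value G i w = g"
  using assms(2)
proof (induction rule: generate.induct)
  case one
  show ?case
    by (intro exI[of _ "[]"]) simp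
next
  case (incl h)
  then obtain x where "x \<in> A" "h = i x" by auto
  then show ?case
    using assms(1) by (intro exI[of _ "[(x, True)]"]) auto
next
  case (inv h)
  then obtain x where "x \<in> A" "h = i x" by auto
  then show ?case
    using assms(1) by (intro exI[of _ "[(x, False)]"]) auto
next
  case (eng g h)
  then obtain u v where "fst ` set u \<subseteq> A" "word_value G i u = g"
    "fst ` set v \<subseteq> A" "word_value G i v = h"
    by blast
  then show ?case
    using assms(1) by (intro exI[of _ "u @ v"]) (auto simp: word_value_append image_subset_iff)
qed

lemma word_value_cancel:
  assumes "i ` fst ` set (u @ (x, b) # (x, \<not> b) # v) \<subseteq> carrier G"
  shows "word_value G i (u @ (x, b) # (x, \<not> b) # v) = word_value G i (u @ v)"
proof -
  have "i x \<otimes> (inv i x \<otimes> word_value G i v) = word_value G i v"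
    "inv i x \<otimes> (i x \<otimes> word_value G i v) = word_value G i v"
    using assms by (simp_all add: m_assoc[symmetric] image_Un)
  then show ?thesis
    using assms by (cases b) (simp_all add: word_value_append image_subset_iff)
qed

end

lemma (in comm_group) word_value_move:
  assumes "i ` fst ` set (u @ (x, b) # v) \<subseteq> carrier G"
  shows "word_value G i (u @ (x, b) # v) = word_value G i ((x, b) # u @ v)"
  using assms by (auto simp: word_value_append m_lcomm image_Un)

lemma not_reduced_word_split:
  "\<not> reduced_word w \<Longrightarrow> \<exists>u x b v. w = u @ (x, b) # (x, \<not> b) # v"
proof (induction w rule: induct_list012)
  case (3 p q w)
  obtain x b y c where [simp]: "p = (x, b)" "q = (y, c)"
    by fastforce
  show ?case
  proof (cases "x = y \<and> b \<noteq> c")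
    case True
    then show ?thesis
      by (intro exI[of _ "[]"] exI[of _ x] exI[of _ b] exI[of _ w]) auto
  next
    case False
    then have "\<not> reduced_word (q # w)"
      using 3(3) by (auto simp: reduced_word_def)
    then obtain u x b v where "q # w = u @ (x, b) # (x, \<not> b) # v"
      using 3(2) by blast
    then show ?thesis
      by (metis append_Cons)
  qed
qed (auto simp: reduced_word_def)

text \<open>Either of the two opposite letters may come first, which is why the sign
  \<open>b\<close> is left open.\<close>

lemma not_abelian_reduced_word_split:
  assumes "\<not> abelian_reduced_word w"
  shows "\<exists>u x b v t. w = u @ (x, b) # v @ (x, \<not> b) # t"
proof -
  obtain x where "(x, True) \<in> set w" "(x, False) \<in> set w"
    using assms by (auto simp: abelian_reduced_word_def)
  then obtain u s where w: "w = u @ (x, True) # s"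
    by (meson split_list)
  then consider "(x, False) \<in> set u" | "(x, False) \<in> set s"
    using \<open>(x, False) \<in> set w\<close> by auto
  then show ?thesis
  proof cases
    case 1
    then obtain u' v where "u = u' @ (x, False) # v"
      by (meson split_list)
    then show ?thesis
      using w by (intro exI[of _ u'] exI[of _ x] exI[of _ False] exI[of _ v] exI[of _ s]) simp
  next
    case 2
    then obtain v t where "s = v @ (x, False) # t"
      by (meson split_list)
    then show ?thesis
      using w by (intro exI[of _ u] exI[of _ x] exI[of _ True] exI[of _ v] exI[of _ t]) simp
  qed
qed

text \<open>Repeated shortening must stop, since lengths decrease, and it stops at a word satisfying
  \<open>R\<close>. The predicate is abstract so that both notions of reduced word are
  covered.\<close>

lemma (in group) Union_balls:
  fixes A :: "'x set"
  assumes i: "i ` A \<subseteq> carrier G" and gen: "generate G (i ` A) = carrier G"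
    and shorten: "\<And>w. \<lbrakk>fst ` set w \<subseteq> A; \<not> R w\<rbrakk> \<Longrightarrow>
      \<exists>w'. fst ` set w' \<subseteq> A \<and> length w' < length w \<and> word_value G i w' = word_value G i w"
  shows "(\<Union>n. {word_value G i w | w. fst ` set w \<subseteq> A \<and> R w \<and> length w \<le> n}) = carrier G"
proof
  show "(\<Union>n. {word_value G i w | w. fst ` set w \<subseteq> A \<and> R w \<and> length w \<le> n}) \<subseteq> carrier G"
  proof clarify
    fix w :: "'x group_word"
    assume "fst ` set w \<subseteq> A"
    then show "word_value G i w \<in> carrier G"
      using i by (intro word_value_closed) (meson image_mono order_trans)
  qed
  have reduce: "\<exists>w'. fst ` set w' \<subseteq> A \<and> R w' \<and> word_value G i w' = word_value G i w"
    if "fst ` set w \<subseteq> A" for w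
    using that
  proof (induction "length w" arbitrary: w rule: less_induct)
    case less
    show ?case
    proof (cases "R w")
      case True
      with less.prems show ?thesis by blast
    next
      case False
      then obtain v where v: "fst ` set v \<subseteq> A" "length v < length w"
        "word_value G i v = word_value G i w"
        using shorten[OF less.prems False] by blast
      then show ?thesis
        using less.hyps[of v] by simp
    qed
  qed
  show "carrier G \<subseteq> (\<Union>n. {word_value G i w | w. fst ` set w \<subseteq> A \<and> R w \<and> length w \<le> n})"
  proof
    fix g
    assume "g \<in> carrier G"
    then obtain w where "fst ` set w \<subseteq> A" "word_value G i w = g"
      using generate_word_value[OF i, of g] gen by metis
    then obtain v where "fst ` set v \<subseteq> A" "R v" "g = word_value G i v"
      using reduce[of w] by metis
    then show "g \<in> (\<Union>n. {word_value G i w | w. fst ` set w \<subseteq> A \<and> R w \<and> length w \<le> n})"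
      by (intro UN_I[of "length v"] UNIV_I CollectI exI[of _ v] conjI order_refl)
  qed
qed

lemma (in group) Union_free_ball:
  fixes X :: "'x topology"
  assumes i: "i ` topspace X \<subseteq> carrier G" and "generate G (i ` topspace X) = carrier G"
  shows "(\<Union>n. free_ball X G i n) = carrier G"
  unfolding free_ball_def
proof (rule Union_balls[OF assms])
  fix w :: "'x group_word"
  assume w: "fst ` set w \<subseteq> topspace X" "\<not> reduced_word w"
  obtain u x b v where "w = u @ (x, b) # (x, \<not> b) # v"
    using not_reduced_word_split[OF w(2)] by (elim exE)
  moreover from this w(1) i have "word_value G i w = word_value G i (u @ v)"
    by (simp add: word_value_cancel image_subset_iff)
  ultimately show "\<exists>w'. fst ` set w' \<subseteq> topspace X \<and> length w' < length w \<and>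
      word_value G i w' = word_value G i w"
    using w(1) by (intro exI[of _ "u @ v"]) auto
qed

lemma (in comm_group) Union_free_abelian_ball:
  fixes X :: "'x topology"
  assumes i: "i ` topspace X \<subseteq> carrier G" and "generate G (i ` topspace X) = carrier G"
  shows "(\<Union>n. free_abelian_ball X G i n) = carrier G"
  unfolding free_abelian_ball_def
proof (rule Union_balls[OF assms])
  fix w :: "'x group_word"
  assume w: "fst ` set w \<subseteq> topspace X" "\<not> abelian_reduced_word w"
  obtain u x b v t where eq: "w = u @ (x, b) # v @ (x, \<not> b) # t"
    using not_abelian_reduced_word_split[OF w(2)] by (elim exE)
  have *: "i ` fst ` set w \<subseteq> carrier G"
    using w i by blast
  \<comment> \<open>The first letter moves to the front, then its inverse moves past
    \<open>u @ v\<close> to stand next to it. The prefix \<open>[] @\<close> below gives the shape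
    that \<open>word_value_cancel\<close> expects.\<close>
  have "word_value G i w = word_value G i ((x, b) # (u @ v) @ (x, \<not> b) # t)"
    using * word_value_move[of i u x b "v @ (x, \<not> b) # t"] unfolding eq by simp
  also have "\<dots> = word_value G i ([] @ (x, b) # (x, \<not> b) # (u @ v @ t))"
    using * word_value_move[of i "u @ v" x "\<not> b" t] unfolding eq
    by (simp add: image_Un)
  also have "\<dots> = word_value G i (u @ v @ t)"
    using * word_value_cancel[of i "[]" x b "u @ v @ t"] unfolding eq by (simp add: image_Un)
  finally show "\<exists>w'. fst ` set w' \<subseteq> topspace X \<and> length w' < length w \<and>
      word_value G i w' = word_value G i w"
    using w(1) eq by (intro exI[of _ "u @ v @ t"]) auto
qed

section \<open>The universal property forces a P-space\<close>

text \<open>The conditional commutativity in the last hypothesis lets one argument serve both cases: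
  the test group is a copy of \<open>G\<close>, so it is Abelian whenever \<open>G\<close>
  is.\<close>

lemma P_space_of_extends_continuously:
  fixes X :: "'a topology" and G :: "('g, 'm) monoid_scheme"
  assumes X: "P_space X" and pG: "paratopological_group G T" and i: "continuous_map X T i"
    and gen: "generate G (i ` topspace X) = carrier G"
    and ext: "\<And>(H :: 'a group_word monoid) S.
      \<lbrakk>paratopological_group H S; comm_group G \<Longrightarrow> comm_group H\<rbrakk> \<Longrightarrow>
      extends_continuously X i G T H S"
  shows "P_space T"
proof -
  interpret group G
    using pG by (simp add: paratopological_group_def)
  have T: "topspace T = carrier G"
    using pG by (simp add: paratopological_group_def)
  have iX: "i ` topspace X \<subseteq> carrier G"
    using i T by (auto simp: continuous_map_def)
  \<comment> \<open>\<open>\<phi>\<close> chooses one spelling of each element. Decoding by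
    \<open>\<psi>\<close> inverts it, so \<open>H\<close> below is \<open>G\<close> with its
    structure carried over to the chosen words.\<close>
  obtain \<phi> :: "'g \<Rightarrow> 'a group_word" where \<phi>: "\<And>g. g \<in> carrier G \<Longrightarrow> word_value G i (\<phi> g) = g"
    using generate_word_value[OF iX] unfolding gen by metis
  define \<psi> where "\<psi> = word_value G i"
  define H where "H = \<lparr>carrier = \<phi> ` carrier G,
    monoid.mult = (\<lambda>u v. \<phi> (\<psi> u \<otimes>\<^bsub>G\<^esub> \<psi> v)), one = \<phi> \<one>\<^bsub>G\<^esub>\<rparr>"
  have \<psi>\<phi>: "\<psi> (\<phi> g) = g" if "g \<in> carrier G" for g
    using \<phi> that by (simp add: \<psi>_def)
  have \<phi>_iso: "\<phi> \<in> iso G H"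
    by (auto simp: iso_def hom_def H_def bij_betw_def \<psi>\<phi> intro: inj_on_inverseI[of _ \<psi>])
  have \<psi>_iso: "\<psi> \<in> iso H G"
    by (force simp: iso_def hom_def H_def bij_betw_def \<psi>\<phi> inj_on_def image_image)
  \<comment> \<open>\<open>iso_imp_img_group\<close> resets the unit of the target to the image of
    the unit; \<open>H\<close> was defined with exactly that unit, so it is unchanged.\<close>
  have "group H"
    using iso_imp_img_group[OF \<phi>_iso] by (simp add: H_def)
  have "comm_group H" if "comm_group G"
    using comm_group.iso_imp_img_comm_group[OF that \<phi>_iso] by (simp add: H_def)
  let ?P = "P_modification T"
  let ?S = "pullback_topology (carrier H) \<psi> ?P"
  have "paratopological_group H ?S"
    using paratopological_group_pullback[OF paratopological_group_P_modification[OF pG]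
        \<open>group H\<close> \<psi>_iso] .
  then have "extends_continuously X i G T H ?S"
    using \<open>comm_group G \<Longrightarrow> comm_group H\<close> by (rule ext)
  \<comment> \<open>Continuity into a pullback is tested after \<open>\<psi>\<close>, which turns
    \<open>\<phi> \<circ> i\<close> back into \<open>i\<close>, a continuous map into the refinement
    because \<open>X\<close> is a P-space.\<close>
  moreover have "continuous_map X ?S (\<phi> \<circ> i)"
  proof (rule continuous_map_pullback')
    have "continuous_map X ?P i"
      using X i by (rule continuous_map_P_modification)
    then show "continuous_map X ?P (\<psi> \<circ> (\<phi> \<circ> i))"
      by (rule continuous_map_eq) (use iX \<psi>\<phi> in auto)
    show "topspace X \<subseteq> (\<phi> \<circ> i) -` carrier H"
      using iX by (auto simp: H_def)
  qed
  ultimately obtain h where h: "h \<in> hom G H" "continuous_map T ?S h"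
    "\<And>x. x \<in> topspace X \<Longrightarrow> h (i x) = \<phi> (i x)"
    unfolding extends_continuously_def by auto
  \<comment> \<open>The homomorphisms \<open>h\<close> and \<open>\<phi>\<close> agree on the
    generators, hence everywhere. Thus \<open>\<psi> \<circ> h\<close> is the identity on
    \<open>G\<close>, and its continuity into \<open>?P\<close> says that the refinement adds no
    open sets.\<close>
  have h\<phi>: "h g = \<phi> g" if "g \<in> carrier G" for g
    using hom_eq_on_generate[OF is_group \<open>group H\<close> h(1) _ iX, of \<phi> g] \<phi>_iso h(3) that gen
    by (auto simp: iso_def)
  have "continuous_map ?S ?P \<psi>"
    using continuous_map_pullback[OF continuous_map_id, of "carrier H" \<psi> ?P] by (simp add: comp_def)
  then have "continuous_map T ?P (\<psi> \<circ> h)"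
    using h(2) continuous_map_compose by blast
  then have id: "continuous_map T ?P (\<lambda>g. g)"
    by (rule continuous_map_eq) (simp add: T \<psi>\<phi> h\<phi>)
  show ?thesis
    unfolding P_space_def
  proof (intro allI impI)
    fix W
    assume W: "gdelta_in T W"
    then have "openin T ((\<lambda>g. g) -` W \<inter> topspace T)"
      using id gdelta_in_imp_openin_P_modification unfolding continuous_map_alt by blast
    then show "openin T W"
      using gdelta_in_subset[OF W] by (simp add: Int_absorb2)
  qed
qed

section \<open>The free and the free Abelian case\<close>

lemma direct_limit_property_free:
  assumes X: "P_space X" and free: "free_paratopological_group X G T i"
  shows "direct_limit_property T (free_ball X G i)"
proof -
  have G: "paratopological_group G T" "generate G (i ` topspace X) = carrier G"
    and i: "continuous_map X T i"
    using free by (auto simp: free_paratopological_group_def embedding_map_def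
        continuous_map_in_subtopology dest!: homeomorphic_imp_continuous_map)
  have T: "topspace T = carrier G" "group G"
    using G(1) by (auto simp: paratopological_group_def)
  have "P_space T"
    using free by (intro P_space_of_extends_continuously[OF X G(1) i G(2)])
      (auto simp: free_paratopological_group_def)
  moreover have "incseq (free_ball X G i)"
    by (auto simp: incseq_def free_ball_def intro: order_trans)
  moreover have "(\<Union>n. free_ball X G i n) = topspace T"
    using group.Union_free_ball[OF T(2) _ G(2)] i T(1) by (auto simp: continuous_map_def)
  ultimately show ?thesis
    by (rule direct_limit_property_P_space)
qed

lemma direct_limit_property_free_abelian:
  assumes X: "P_space X" and free: "free_abelian_paratopological_group X A S j"
  shows "direct_limit_property S (free_abelian_ball X A j)"
proof -
  have A: "paratopological_group A S" "generate A (j ` topspace X) = carrier A"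
      "comm_group A"
    and j: "continuous_map X S j"
    using free by (auto simp: free_abelian_paratopological_group_def embedding_map_def
        continuous_map_in_subtopology dest!: homeomorphic_imp_continuous_map)
  have S: "topspace S = carrier A"
    using A(1) by (auto simp: paratopological_group_def)
  have "P_space S"
    \<comment> \<open>As \<open>A\<close> is commutative, the conditional premise on the test group
      becomes plain commutativity, which is what the Abelian universal property asks for.\<close>
    using free by (intro P_space_of_extends_continuously[OF X A(1) j A(2)])
      (auto simp: free_abelian_paratopological_group_def)
  moreover have "incseq (free_abelian_ball X A j)"
    by (auto simp: incseq_def free_abelian_ball_def intro: order_trans)
  moreover have "(\<Union>n. free_abelian_ball X A j n) = topspace S"
    using comm_group.Union_free_abelian_ball[OF A(3) _ A(2)] j S by (auto simp: continuous_map_def)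
  ultimately show ?thesis
    by (rule direct_limit_property_P_space)
qed

theorem theorem3p8:
  fixes X :: "'a topology"
    and G :: "('g, 'm) monoid_scheme" and T :: "'g topology" and i :: "'a \<Rightarrow> 'g"
    and A :: "('h, 'n) monoid_scheme" and S :: "'h topology" and j :: "'a \<Rightarrow> 'h"
  assumes "t0_space X" and "P_space X"
  shows "(free_paratopological_group X G T i
            \<longrightarrow> direct_limit_property T (free_ball X G i)) \<and>
         (free_abelian_paratopological_group X A S j
            \<longrightarrow> direct_limit_property S (free_abelian_ball X A j))"
  using assms(2) direct_limit_property_free direct_limit_property_free_abelian by blast

end
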